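(* Let $p$ be a prime and let $P$ be a cyclic normal Sylow $p$-subgroup of a finite group $G$. Then $$\Omega_{\rho}\left(\frac{G}{P}\right)\geq \frac{\Omega_{\rho}(G)\cdot|P|-\Omega_{\rho}(P)\cdot|G|}{|P|^2}.$$ Furthermore, equality $$\Omega_{\rho}\left(\frac{G}{P}\right)= \frac{\Omega_{\rho}(G)\cdot|P|-\Omega_{\rho}(P)\cdot|G|}{|P|^2}$$ holds if and only if $P$ is central in $G$.
   Context: For a finite group $G$, let $o(x)$ denote the order of $x\in G$ and set $\rho(G)=\prod_{x\in G} o(x)$. For a positive integer $m=p_1^{\alpha_1}\cdots p_k^{\alpha_k}$ with $p_1,\dots,p_k$ distinct primes, $\Omega(m)=\alpha_1+\cdots+\alpha_k$ is the number of prime factors of $m$ counted with multiplicity (so $\Omega(1)=0$). Define $\Omega_{\rho}(G)=\Omega(\rho(G))$. A subgroup $P$ is central in $G$ if it is contained in the center of $G$. *)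

theory Defs
  imports "HOL-Algebra.Algebra"
begin

definition rho :: "('a, 'b) monoid_scheme \<Rightarrow> nat" where
  "rho G = (\<Prod>x\<in>carrier G. group.ord G x)"

definition Omega :: "nat \<Rightarrow> nat" where
  "Omega m = (\<Sum>p\<in>prime_factors m. multiplicity p m)"

definition Omega_rho :: "('a, 'b) monoid_scheme \<Rightarrow> nat" where
  "Omega_rho G = Omega (rho G)"

definition group_center :: "('a, 'b) monoid_scheme \<Rightarrow> 'a set" where
  "group_center G = {z \<in> carrier G. \<forall>x\<in>carrier G. z \<otimes>\<^bsub>G\<^esub> x = x \<otimes>\<^bsub>G\<^esub> z}"

(* The trivial subgroup is a Sylow p-subgroup when p does not divide the order of G. *)
definition sylow_subgroup :: "nat \<Rightarrow> 'a set \<Rightarrow> ('a, 'b) monoid_scheme \<Rightarrow> bool" where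
  "sylow_subgroup p P G \<longleftrightarrow> subgroup P G \<and> card P = p ^ multiplicity p (order G)"

end

theory Submission
  imports Defs
begin

text \<open>
  Since \<open>\<Omega>\<close> is additive, \<open>\<Omega>\<^sub>\<rho>(G)\<close> is the sum of \<open>\<Omega>(o(y))\<close> over all \<open>y\<close> in
  \<open>G\<close>, and this sum can be split along the cosets of the normal subgroup. After clearing
  denominators the claim reads
  \<open>\<Omega>\<^sub>\<rho>(G) \<le> |P| \<Omega>\<^sub>\<rho>(G/P) + |G/P| \<Omega>\<^sub>\<rho>(P)\<close>, and it holds coset by coset
  (\<open>sum_Omega_coset\<close>).

  Let \<open>C\<close> be a coset of order \<open>m\<close> in \<open>G/P\<close>. As \<open>m\<close> is coprime to \<open>|P|\<close>, the coset contains
  an \<open>x\<close> with \<open>x^m = 1\<close> (\<open>exists_coset_representative_same_ord\<close>). Each element of \<open>C\<close> is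
  \<open>xz\<close> with \<open>z\<close> in \<open>P\<close>, and \<open>o(xz) = m o((xz)^m)\<close>, where \<open>(xz)^m\<close> lies in \<open>P\<close>. The
  elements of \<open>P\<close> with order dividing \<open>o(z)\<close> form a subgroup normal in \<open>G\<close>, because \<open>P\<close> is
  abelian; modulo it \<open>(xz)^m\<close> equals \<open>x^m = 1\<close>, so \<open>o((xz)^m)\<close> divides \<open>o(z)\<close>
  (\<open>pow_mult_normal_torsion\<close>). Summing over \<open>z\<close> gives the inequality.

  Equality on \<open>C\<close> forces \<open>z = 1\<close> whenever \<open>(xz)^m = 1\<close>. For \<open>w\<close> in \<open>P\<close> the conjugate of \<open>x\<close>
  by \<open>w\<close> has the form \<open>xz\<close> and its \<open>m\<close>-th power is \<open>1\<close>; hence it equals \<open>x\<close>, and \<open>x\<close>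
  commutes with \<open>w\<close>. Conversely, if \<open>x\<close> centralizes \<open>P\<close> then \<open>(xz)^m = z^m\<close> has the same
  order as \<open>z\<close>. Thus equality on all cosets means that \<open>P\<close> is central.

  The argument applies to every abelian normal Hall subgroup
  (\<open>Omega_rho_abelian_normal_Hall\<close>), of which a cyclic normal Sylow subgroup is an instance.
\<close>

section \<open>The number of prime factors\<close>

lemma Omega_eq_size: "Omega n = size (prime_factorization n)"
  by (auto simp: Omega_def size_multiset_overloaded_eq count_prime_factorization_prime
      dest: in_prime_factors_imp_prime intro!: sum.cong)

lemma Omega_mult:
  assumes "a \<noteq> 0" and "b \<noteq> 0"
  shows "Omega (a * b) = Omega a + Omega b"
  using assms by (simp add: Omega_eq_size prime_factorization_mult)

lemma Omega_prod:
  assumes "finite A" and "\<And>x. x \<in> A \<Longrightarrow> f x \<noteq> 0"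
  shows "Omega (\<Prod>x\<in>A. f x) = (\<Sum>x\<in>A. Omega (f x))"
  using assms
  by (induction A rule: finite_induct) (simp_all add: Omega_mult, simp add: Omega_eq_size)

lemma Omega_eq_0_iff:
  assumes "n \<noteq> 0"
  shows "Omega n = 0 \<longleftrightarrow> n = 1"
  using assms by (simp add: Omega_eq_size prime_factorization_empty_iff)

lemma Omega_dvd_mono:
  assumes "a dvd b" and "b \<noteq> 0"
  shows "Omega a \<le> Omega b"
  using assms by (auto simp: Omega_mult elim!: dvdE)

lemma (in group) Omega_rho_eq_sum:
  assumes "finite (carrier G)"
  shows "Omega_rho G = (\<Sum>x\<in>carrier G. Omega (ord x))"
  unfolding Omega_rho_def rho_def
  using assms ord_ge_1 by (intro Omega_prod) fastforce+

lemma (in group) ord_subgroup_eq: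
  assumes "subgroup H G" and "x \<in> H"
  shows "group.ord (G\<lparr>carrier := H\<rparr>) x = ord x"
proof -
  interpret H: group "G\<lparr>carrier := H\<rparr>"
    by (rule subgroup.subgroup_is_group[OF assms(1) is_group])
  have "x \<in> carrier G"
    using assms subgroup.mem_carrier by fast
  then show ?thesis
    using assms(2) by (simp add: H.ord_unique pow_eq_id flip: nat_pow_consistent)
qed

lemma (in group) mult_inv_cancel:
  assumes "a \<in> carrier G" and "b \<in> carrier G"
  shows "a \<otimes> (inv a \<otimes> b) = b" and "inv a \<otimes> (a \<otimes> b) = b"
  using assms by (simp_all flip: m_assoc)

lemma (in group) pow_conjugate:
  assumes "a \<in> carrier G" and "b \<in> carrier G"
  shows "(a \<otimes> b \<otimes> inv a) [^] (n::nat) = a \<otimes> b [^] n \<otimes> inv a"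
proof (induction n)
  case 0
  show ?case using assms by simp
next
  case (Suc n)
  then show ?case
    using assms by (simp add: m_assoc mult_inv_cancel)
qed

section \<open>Orders of elements in a coset of a normal subgroup\<close>

context normal
begin

lemma ord_FactGroup_dvd_iff:
  assumes "x \<in> carrier G"
  shows "group.ord (G Mod H) (H #> x) dvd n \<longleftrightarrow> x [^] n \<in> H"
proof -
  interpret Q: group "G Mod H"
    by (rule factorgroup_is_group)
  have "H #> x \<in> carrier (G Mod H)"
    using assms by (simp add: carrier_FactGroup)
  then have "group.ord (G Mod H) (H #> x) dvd n \<longleftrightarrow> H #> (x [^] n) = H"
    using Q.pow_eq_id[of "H #> x" n] assms by (simp add: FactGroup_pow)
  also have "\<dots> \<longleftrightarrow> x [^] n \<in> H"
    using assms by (metis coset_join1 coset_join2 nat_pow_closed subgroup_axioms)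
  finally show ?thesis .
qed

text \<open>The order of the coset divides the order of \<open>x\<close>, so passing to that power of \<open>x\<close> divides
  the order exactly.\<close>

lemma ord_eq_ord_FactGroup_mult:
  assumes "finite (carrier G)" and "x \<in> carrier G"
  shows "ord x = group.ord (G Mod H) (H #> x) * ord (x [^] group.ord (G Mod H) (H #> x))"
proof -
  let ?m = "group.ord (G Mod H) (H #> x)"
  have "?m dvd ord x"
    using assms(2) by (simp add: ord_FactGroup_dvd_iff)
  moreover have "ord x > 0"
    using ord_ge_1 assms by fastforce
  ultimately show ?thesis
    using ord_pow[OF assms(2), of ?m] by fastforce
qed

lemma subgroup_elem_pow_card:
  assumes "h \<in> H"
  shows "h [^] card H = \<one>"
proof -
  interpret H: group "G\<lparr>carrier := H\<rparr>"
    by (rule subgroup_is_group[OF is_group])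
  show ?thesis
    using H.pow_order_eq_1[of h] assms by (simp add: order_def flip: nat_pow_consistent)
qed

text \<open>With \<open>m\<close> the order of the coset, raising an element \<open>y\<close> of it to a multiple of
  \<open>|H|\<close> that is congruent to 1 modulo \<open>m\<close> leaves the coset unchanged but kills the part of
  \<open>y\<close> that comes from \<open>H\<close>.\<close>

lemma exists_coset_representative_same_ord:
  assumes "finite (carrier G)" and "coprime (card H) (card (rcosets H))" and "C \<in> rcosets H"
  obtains x where "x \<in> carrier G" and "C = H #> x" and "x [^] group.ord (G Mod H) C = \<one>"
proof -
  interpret Q: group "G Mod H"
    by (rule factorgroup_is_group)
  obtain y where y: "y \<in> carrier G" "C = H #> y"
    using assms(3) by (auto simp: RCOSETS_def)
  define m where "m = Q.ord C"
  have C: "C \<in> carrier (G Mod H)"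
    using assms(3) by (simp add: FactGroup_def)
  have "m dvd card (rcosets H)"
    using Q.ord_dvd_group_order[OF C] by (simp add: m_def FactGroup_def order_def)
  then have "coprime (card H) m"
    using assms(2) coprime_divisors dvd_refl by blast
  then obtain u v where "u * int (card H) + v * int m = 1"
    using bezout_int[of "int (card H)" "int m"] by auto
  then have "int m dvd 1 - int (card H) * u"
    by (metis add_diff_cancel_left' dvd_triv_right mult.commute)
  then have "C [^]\<^bsub>G Mod H\<^esub> (int (card H) * u) = C"
    using Q.int_pow_eq[OF C, of "int (card H) * u" 1] C by (simp add: m_def)
  then have "C = H #> (y [^] (int (card H) * u))"
    using y by (simp add: FactGroup_int_pow)
  moreover have "(y [^] (int (card H) * u)) [^] m = \<one>"
  proof -
    have "y [^] m \<in> H"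
      using y by (simp add: m_def flip: ord_FactGroup_dvd_iff)
    then have "y [^] (m * card H) = \<one>"
      using y(1) subgroup_elem_pow_card by (simp flip: nat_pow_pow)
    then have "(y [^] int (m * card H)) [^] u = \<one>"
      unfolding int_pow_int by simp
    then have "y [^] (int (m * card H) * u) = \<one>"
      using y(1) by (simp only: int_pow_pow)
    then have "(y [^] (int (card H) * u)) [^] int m = \<one>"
      using y(1) by (simp add: int_pow_pow mult_ac)
    then show ?thesis
      by (simp add: int_pow_int)
  qed
  ultimately show thesis
    using that[of "y [^] (int (card H) * u)"] y unfolding m_def by simp
qed

text \<open>The elements \<open>q\<close> of an abelian \<open>H\<close> with \<open>q^k = 1\<close> form a subgroup which is normal in
  \<open>G\<close>, since conjugation preserves \<open>H\<close> and orders. The lemma is the congruence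
  \<open>(xz)^n = x^n\<close> modulo this subgroup. In the induction step a factor \<open>q\<close> is moved
  past \<open>x\<close> and becomes its conjugate.\<close>

lemma pow_mult_normal_torsion:
  assumes comm: "\<And>a b. a \<in> H \<Longrightarrow> b \<in> H \<Longrightarrow> a \<otimes> b = b \<otimes> a"
    and x: "x \<in> carrier G" and z: "z \<in> H" "z [^] (k::nat) = \<one>"
  shows "\<exists>q\<in>H. q [^] k = \<one> \<and> (x \<otimes> z) [^] (n::nat) = x [^] n \<otimes> q"
proof (induction n)
  case 0
  show ?case
    by (intro bexI[of _ "\<one>"]) auto
next
  case (Suc n)
  then obtain q where q: "q \<in> H" "q [^] k = \<one>" "(x \<otimes> z) [^] n = x [^] n \<otimes> q"
    by blast
  have q_carrier: "q \<in> carrier G" and z_carrier: "z \<in> carrier G"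
    using q(1) z(1) by auto
  define c where "c = inv x \<otimes> q \<otimes> x"
  have c: "c \<in> H"
    unfolding c_def using inv_op_closed1 x q(1) by blast
  have "c [^] k = \<one>"
    unfolding c_def using pow_conjugate[of "inv x" q k] x q_carrier by (simp add: q(2))
  then have "(c \<otimes> z) [^] k = \<one>"
    using pow_mult_distrib[of c z k] comm[OF c z(1)] c z by simp
  moreover have "(x \<otimes> z) [^] Suc n = x [^] Suc n \<otimes> (c \<otimes> z)"
  proof -
    have "q \<otimes> x = x \<otimes> c"
      unfolding c_def using x q_carrier by (simp add: inv_solve_left' flip: m_assoc)
    then have "q \<otimes> (x \<otimes> z) = x \<otimes> (c \<otimes> z)"
      using x q_carrier z_carrier c by (metis m_assoc mem_carrier)
    then show ?thesis
      using x q_carrier z_carrier c by (simp add: q(3) m_assoc)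
  qed
  ultimately show ?case
    using c z(1) by blast
qed

section \<open>The estimate on a single coset\<close>

text \<open>Both parts compare \<open>o((xz)^m)\<close> with \<open>o(z)\<close> for each \<open>z\<close> in \<open>H\<close>, where \<open>x\<close> is a
  representative with \<open>x^m = 1\<close>. For the equality case only those \<open>z\<close> matter for which \<open>xz\<close>
  is a conjugate of \<open>x\<close> by an element of \<open>H\<close>; there the left-hand order is 1.\<close>

lemma sum_Omega_coset:
  assumes fin: "finite (carrier G)"
    and comm: "\<And>a b. a \<in> H \<Longrightarrow> b \<in> H \<Longrightarrow> a \<otimes> b = b \<otimes> a"
    and cop: "coprime (card H) (card (rcosets H))"
    and C: "C \<in> rcosets H"
  defines "m \<equiv> group.ord (G Mod H) C"
  shows sum_Omega_coset_le:
      "(\<Sum>y\<in>C. Omega (ord y)) \<le> card H * Omega m + (\<Sum>z\<in>H. Omega (ord z))" (is ?le)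
    and sum_Omega_coset_eq_iff:
      "(\<Sum>y\<in>C. Omega (ord y)) = card H * Omega m + (\<Sum>z\<in>H. Omega (ord z))
        \<longleftrightarrow> (\<forall>y\<in>C. \<forall>z\<in>H. y \<otimes> z = z \<otimes> y)" (is "?eq \<longleftrightarrow> ?commute")
proof -
  interpret Q: group "G Mod H"
    by (rule factorgroup_is_group)
  obtain x where x: "x \<in> carrier G" "C = H #> x" "x [^] m = \<one>"
    using exists_coset_representative_same_ord[OF fin cop C] unfolding m_def by blast
  have fin_H: "finite H"
    using fin finite_subset subset by blast
  have C_eq: "C = (\<lambda>z. x \<otimes> z) ` H"
    using x coset_eq by (auto simp: l_coset_def)
  have inj: "inj_on (\<lambda>z. x \<otimes> z) H"
    using x by (auto intro!: inj_onI)
  have m_dvd: "m dvd card (rcosets H)"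
    using Q.ord_dvd_group_order[of C] C by (simp add: m_def FactGroup_def order_def)
  have ord_pos: "ord g \<noteq> 0" if "g \<in> carrier G" for g
    using ord_ge_1[OF fin that] by simp
  have split: "ord (x \<otimes> z) = m * ord ((x \<otimes> z) [^] m)" if "z \<in> H" for z
  proof -
    have "x \<otimes> z \<in> C"
      using that by (simp add: C_eq)
    then have "C = H #> (x \<otimes> z)"
      using x repr_independence[OF _ x(1) subgroup_axioms] by simp
    then show ?thesis
      using ord_eq_ord_FactGroup_mult[OF fin, of "x \<otimes> z"] that x(1) by (simp add: m_def)
  qed
  have m_pos: "m \<noteq> 0"
    using split[of \<one>] ord_pos[of x] x by force
  have Omega_split: "Omega (ord (x \<otimes> z)) = Omega m + Omega (ord ((x \<otimes> z) [^] m))"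
    if "z \<in> H" for z
    using split[OF that] that x(1) m_pos by (simp add: Omega_mult ord_pos)
  have sum_eq: "(\<Sum>y\<in>C. Omega (ord y))
      = card H * Omega m + (\<Sum>z\<in>H. Omega (ord ((x \<otimes> z) [^] m)))"
    unfolding C_eq using inj by (simp add: sum.reindex Omega_split sum.distrib)
  have le: "Omega (ord ((x \<otimes> z) [^] m)) \<le> Omega (ord z)" if z: "z \<in> H" for z
  proof (rule Omega_dvd_mono)
    obtain q where q: "q \<in> H" "q [^] ord z = \<one>" "(x \<otimes> z) [^] m = x [^] m \<otimes> q"
      using pow_mult_normal_torsion[OF comm x(1) z, of "ord z" m] z by auto
    then show "ord ((x \<otimes> z) [^] m) dvd ord z"
      using x(3) by (simp flip: pow_eq_id)
    show "ord z \<noteq> 0"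
      using ord_pos z by simp
  qed
  then show ?le
    unfolding sum_eq by (intro add_left_mono sum_mono)
  show "?eq \<longleftrightarrow> ?commute"
  proof
    assume ?eq
    then have eq: "Omega (ord ((x \<otimes> z) [^] m)) = Omega (ord z)" if "z \<in> H" for z
      using sum_mono_inv[of "\<lambda>z. Omega (ord ((x \<otimes> z) [^] m))" H "\<lambda>z. Omega (ord z)" z]
        le that fin_H by (simp add: sum_eq)
    have x_comm: "x \<otimes> w = w \<otimes> x" if w: "w \<in> H" for w
    proof -
      have w_carrier: "w \<in> carrier G"
        using w by simp
      \<comment> \<open>Chosen so that \<open>x \<otimes> z\<close> is the conjugate of \<open>x\<close> by \<open>w\<close>.\<close>
      define z where "z = inv x \<otimes> w \<otimes> x \<otimes> inv w"
      have z: "z \<in> H"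
        unfolding z_def using inv_op_closed1[OF x(1) w] w by simp
      have xz: "x \<otimes> z = w \<otimes> x \<otimes> inv w"
        unfolding z_def using x(1) w_carrier by (simp add: m_assoc mult_inv_cancel)
      have "(x \<otimes> z) [^] m = \<one>"
        using xz x(1,3) w_carrier by (simp add: pow_conjugate)
      then have "Omega (ord z) = 0"
        using eq[OF z] Omega_eq_0_iff[of 1] by simp
      then have "z = \<one>"
        using Omega_eq_0_iff ord_pos ord_eq_1 z by simp
      then have "x = w \<otimes> x \<otimes> inv w"
        using xz x(1) by simp
      then show ?thesis
        using x(1) w_carrier by (metis inv_closed inv_solve_right m_closed)
    qed
    show ?commute
    proof (intro ballI)
      fix y w
      assume "y \<in> C" and w: "w \<in> H"
      then obtain z where z: "z \<in> H" "y = x \<otimes> z"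
        by (auto simp: C_eq)
      then show "y \<otimes> w = w \<otimes> y"
        using x_comm[OF w] comm[OF z(1) w] x(1) w by (metis m_assoc mem_carrier)
    qed
  next
    assume commute: ?commute
    have "ord ((x \<otimes> z) [^] m) = ord z" if z: "z \<in> H" for z
    proof -
      have "x \<in> C"
        using x rcos_self subgroup_axioms by simp
      then have "x \<otimes> z = z \<otimes> x"
        using commute z by blast
      then have "(x \<otimes> z) [^] m = x [^] m \<otimes> z [^] m"
        using x(1) z by (intro pow_mult_distrib) auto
      then have "(x \<otimes> z) [^] m = z [^] m"
        using x(3) z by simp
      moreover have "coprime m (ord z)"
      proof -
        have "ord z dvd card H"
          using z by (simp add: subgroup_elem_pow_card flip: pow_eq_id)
        then show ?thesis
          using cop m_dvd by (meson coprime_commute coprime_divisors)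
      qed
      ultimately show ?thesis
        using pow_ord_eq_ord_iff[OF fin, of z m] z by simp
    qed
    then show ?eq
      unfolding sum_eq by simp
  qed
qed

section \<open>Abelian normal Hall subgroups\<close>

lemma Omega_rho_abelian_normal_Hall:
  assumes fin: "finite (carrier G)"
    and comm: "\<And>a b. a \<in> H \<Longrightarrow> b \<in> H \<Longrightarrow> a \<otimes> b = b \<otimes> a"
    and cop: "coprime (card H) (card (rcosets H))"
  shows Omega_rho_le_FactGroup:
      "Omega_rho G \<le> card H * Omega_rho (G Mod H)
        + card (rcosets H) * Omega_rho (G\<lparr>carrier := H\<rparr>)" (is "_ \<le> ?R")
    and Omega_rho_eq_FactGroup_iff:
      "Omega_rho G = card H * Omega_rho (G Mod H)
        + card (rcosets H) * Omega_rho (G\<lparr>carrier := H\<rparr>) \<longleftrightarrow> H \<subseteq> group_center G"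
proof -
  interpret Q: group "G Mod H"
    by (rule factorgroup_is_group)
  interpret H: group "G\<lparr>carrier := H\<rparr>"
    by (rule subgroup_is_group[OF is_group])
  let ?f = "\<lambda>C. \<Sum>y\<in>C. Omega (ord y)"
  let ?g = "\<lambda>C. card H * Omega (Q.ord C) + (\<Sum>z\<in>H. Omega (ord z))"
  have fin_H: "finite H"
    using fin finite_subset subset by blast
  have union: "\<Union>(rcosets H) = carrier G"
    by (rule rcosets_part_G[OF subgroup_axioms])
  have fin_cosets: "finite (rcosets H)"
    using fin union finite_UnionD by metis
  have "(\<Sum>x\<in>\<Union>(rcosets H). Omega (ord x)) = sum ?f (rcosets H)"
    using rcos_disjoint[OF subgroup_axioms] fin_H rcosets_finite subset
    by (subst sum.Union_disjoint) (auto simp: pairwise_def disjnt_def)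
  then have lhs: "Omega_rho G = sum ?f (rcosets H)"
    by (simp add: Omega_rho_eq_sum fin union)
  have "Omega_rho (G\<lparr>carrier := H\<rparr>) = (\<Sum>z\<in>H. Omega (ord z))"
    using fin_H by (simp add: H.Omega_rho_eq_sum ord_subgroup_eq subgroup_axioms)
  moreover have "Omega_rho (G Mod H) = (\<Sum>C\<in>rcosets H. Omega (Q.ord C))"
    using fin_cosets Q.Omega_rho_eq_sum by (simp add: FactGroup_def)
  ultimately have rhs: "?R = sum ?g (rcosets H)"
    by (simp add: sum.distrib sum_distrib_left)
  have le: "?f C \<le> ?g C" if "C \<in> rcosets H" for C
    using sum_Omega_coset_le[OF fin comm cop that] .
  show "Omega_rho G \<le> ?R"
    unfolding lhs rhs using le by (intro sum_mono)
  have "Omega_rho G = ?R \<longleftrightarrow> (\<forall>C\<in>rcosets H. ?f C = ?g C)"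
  proof
    assume "Omega_rho G = ?R"
    then have "sum ?f (rcosets H) = sum ?g (rcosets H)"
      unfolding lhs rhs .
    then show "\<forall>C\<in>rcosets H. ?f C = ?g C"
      by (intro ballI, rule sum_mono_inv) (use le fin_cosets in blast)+
  next
    assume "\<forall>C\<in>rcosets H. ?f C = ?g C"
    then show "Omega_rho G = ?R"
      unfolding lhs rhs by (intro sum.cong) blast+
  qed
  also have "\<dots> \<longleftrightarrow> (\<forall>C\<in>rcosets H. \<forall>y\<in>C. \<forall>z\<in>H. y \<otimes> z = z \<otimes> y)"
    by (intro ball_cong refl sum_Omega_coset_eq_iff[OF fin comm cop])
  also have "\<dots> \<longleftrightarrow> (\<forall>y\<in>carrier G. \<forall>z\<in>H. y \<otimes> z = z \<otimes> y)"
    unfolding union[symmetric] by blast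
  also have "\<dots> \<longleftrightarrow> H \<subseteq> group_center G"
    using subset by (fastforce simp: group_center_def)
  finally show "Omega_rho G = ?R \<longleftrightarrow> H \<subseteq> group_center G" .
qed

end

lemma (in group) sylow_subgroup_coprime_index:
  assumes "finite (carrier G)" and "Factorial_Ring.prime p" and "sylow_subgroup p P G"
  shows "coprime (card P) (card (rcosets P))"
proof -
  have P: "subgroup P G" "card P = p ^ multiplicity p (order G)"
    using assms(3) by (auto simp: sylow_subgroup_def)
  have "order G = card (rcosets P) * card P"
    using lagrange[OF P(1)] by simp
  moreover have pos: "order G \<noteq> 0"
    using assms(1) order_gt_0_iff_finite by simp
  ultimately have "card (rcosets P) = order G div p ^ multiplicity p (order G)"
    using P(2) by (metis mult_eq_0_iff nonzero_mult_div_cancel_right)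
  then have "\<not> p dvd card (rcosets P)"
    using multiplicity_decompose[of "order G" p] pos assms(2)
    by (metis not_prime_unit)
  then show ?thesis
    using assms(2) P(2) prime_imp_coprime by (metis coprime_power_left_iff)
qed

theorem mainTheorem3:
  fixes G :: "('a, 'b) monoid_scheme" and P :: "'a set" and p :: nat
  assumes "group G" and "finite (carrier G)"
    and "Factorial_Ring.prime p"
    and "sylow_subgroup p P G"
    and "P \<lhd> G"
    and "cyclic_group (G\<lparr>carrier := P\<rparr>)"
  shows "real (Omega_rho (G Mod P)) \<ge>
      (real (Omega_rho G) * real (card P)
        - real (Omega_rho (G\<lparr>carrier := P\<rparr>)) * real (order G)) / (real (card P))^2
    \<and> (real (Omega_rho (G Mod P)) =
      (real (Omega_rho G) * real (card P)
        - real (Omega_rho (G\<lparr>carrier := P\<rparr>)) * real (order G)) / (real (card P))^2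
       \<longleftrightarrow> P \<subseteq> group_center G)"
proof -
  interpret normal P G
    by (rule assms(5))
  interpret P: comm_group "G\<lparr>carrier := P\<rparr>"
    using subgroup_is_group[OF is_group] group.cyclic_imp_abelian_group assms(6) by blast
  have comm: "a \<otimes>\<^bsub>G\<^esub> b = b \<otimes>\<^bsub>G\<^esub> a" if "a \<in> P" "b \<in> P" for a b
    using P.m_comm that by simp
  note cop = sylow_subgroup_coprime_index[OF assms(2,3,4)]
  define a where "a = real (Omega_rho G)"
  define b where "b = real (Omega_rho (G Mod P))"
  define c where "c = real (Omega_rho (G\<lparr>carrier := P\<rparr>))"
  define n where "n = real (card P)"
  define i where "i = real (card (rcosets\<^bsub>G\<^esub> P))"
  have "P \<noteq> {}"
    using subgroup.one_closed[OF subgroup_axioms] by blast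
  then have n_pos: "n > 0"
    using finite_subset[OF subset assms(2)] by (simp add: n_def card_gt_0_iff)
  have order: "real (order G) = i * n"
    using lagrange[OF subgroup_axioms] unfolding i_def n_def by (metis of_nat_mult)
  have quot: "(a * n - c * real (order G)) / n^2 = (a - i * c) / n"
    using n_pos by (simp add: order power2_eq_square field_simps)
  have le: "a \<le> n * b + i * c"
    using Omega_rho_le_FactGroup[OF assms(2) comm cop]
    unfolding a_def b_def c_def n_def i_def by (simp flip: of_nat_mult of_nat_add)
  have eq_iff: "a = n * b + i * c \<longleftrightarrow> P \<subseteq> group_center G"
    using Omega_rho_eq_FactGroup_iff[OF assms(2) comm cop]
    unfolding a_def b_def c_def n_def i_def by (simp flip: of_nat_mult of_nat_add)
  have "(a - i * c) / n \<le> b"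
    using le n_pos by (simp add: field_simps)
  moreover have "b = (a - i * c) / n \<longleftrightarrow> P \<subseteq> group_center G"
    unfolding eq_iff[symmetric] using n_pos by (auto simp: field_simps)
  ultimately show ?thesis
    unfolding quot[symmetric] unfolding a_def b_def c_def n_def by blast
qed

end
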